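(* Let $\mathtt{finish}\ r$ be a single-clock program, i.e. $r$ contains no clocked finish. For all operations $u,v$ of $\mathtt{finish}\ r$, $$u \prec\!\!\prec v \iff \phi(u) < \phi(v)\ \text{ or }\ u \prec v ,$$ where $\prec\!\!\prec$ is the clocked happens-before relation, $\phi$ is the phase number, and $\prec$ is the unclocked happens-before relation.
   Context: **Programs.** Loops are assumed to have been statically expanded, and the heap is ignored. Statements are $s ::= b \mid \mathtt{advance} \mid \{s\ t\} \mid \mathtt{async}\ s \mid \mathtt{finish}\ s$, where the basic statements $b$ are all treated as $\mathtt{skip}$s carrying pairwise distinct names; the (named) basic statements of a program are its *operations*. "$r$ contains no clocked finish" means that no $\mathtt{advance}$ of $r$ lies inside a $\mathtt{finish}$ that occurs within $r$ (so all advances use the clock of the outer $\mathtt{finish}$). **Reduction.** A configuration is a statement or the terminated configuration $\mathtt{done}$. A statement is asynchronous if it is $\mathtt{async}\ s$, or $\{s\ t\}$ with $s$ and $t$ both asynchronous; otherwise it is synchronous. The relation $\longrightarrow$ is generated by: $b\longrightarrow\mathtt{done}$ for each basic statement $b$; if $s\longrightarrow s'$ then $\mathtt{async}\ s\longrightarrow\mathtt{async}\ s'$, $\mathtt{finish}\ s\longrightarrow\mathtt{finish}\ s'$, $\{s\ t\}\longrightarrow\{s'\ t\}$, and, when $t$ is asynchronous, $\{t\ s\}\longrightarrow\{t\ s'\}$; if $s\longrightarrow\mathtt{done}$ then $\mathtt{async}\ s\longrightarrow\mathtt{done}$, $\mathtt{finish}\ s\longrightarrow\mathtt{done}$, $\{s\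 t\}\longrightarrow t$, and, when $t$ is asynchronous, $\{t\ s\}\longrightarrow t$; and the *clock rule*: if $s$ is stuck and $s\Longrightarrow t$ then $\mathtt{finish}\ s\longrightarrow\mathtt{finish}\ t$. "Stuck" is the least predicate such that: $\mathtt{advance}$ is stuck; $\mathtt{async}\ s$ is stuck if $s$ is; $\{s\ t\}$ is stuck if $s$ is synchronous and stuck, or if $s$ is asynchronous and both $s$ and $t$ are stuck. The clock-step relation $\Longrightarrow$ is generated by: $\mathtt{advance}\Longrightarrow\mathtt{skip}$; $b\Longrightarrow b$; if $s\Longrightarrow t$ then $\mathtt{async}\ s\Longrightarrow\mathtt{async}\ t$, and $\{s\ u\}\Longrightarrow\{t\ u\}$ when $s$ is synchronous; if $s$ is asynchronous, $s\Longrightarrow s'$ and $t\Longrightarrow t'$, then $\{s\ t\}\Longrightarrow\{s'\ t'\}$. **Happens-before relations and phases.** An interpretation of a program is a complete reduction sequence from it to $\mathtt{done}$. For operations $u,v$: $u\prec\!\!\prec v$ iff $u$ is executed before $v$ in every interpretation of the program. Numbering the applications of the clock rule consecutively in an interpretation, $\phi(u)$ is the number of applications of the clock rule that precede the execution of $u$ (this does not depend on the interpretation). The unclocked relation $u\prec v$ is the happens-before relation obtained by ignoring clocks, i.e. by treating every $\mathtt{advance}$ as an ordinary (named) basic statement: $u\prec v$ iff $u$ is executed before $v$ in every interpretation of the program so modified. *)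

theory Defs
  imports Main
begin

text \<open>
  The type parameter is the type of names of operations. \<open>Skip\<close> is the nameless basic
  statement that a clock step puts in the place of an \<open>Advance\<close>.
\<close>

datatype 'a basic = Skip | Op 'a

datatype 'a stmt =
    Basic "'a basic"
  | Advance
  | Seq "'a stmt" "'a stmt"
  | Async "'a stmt"
  | Finish "'a stmt"

datatype 'a config = Done | Cfg "'a stmt"

fun basics :: "'a stmt \<Rightarrow> 'a basic list" where
  "basics (Basic b) = [b]"
| "basics Advance = []"
| "basics (Seq s t) = basics s @ basics t"
| "basics (Async s) = basics s"
| "basics (Finish s) = basics s"

text \<open>
  Programs are the statements in which all basic statements are named, with pairwise distinct
  names. \<open>Skip\<close> occurs only in configurations reached from a program.
\<close>

definition program :: "'a stmt \<Rightarrow> bool" where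
  "program p \<longleftrightarrow> distinct (basics p) \<and> Skip \<notin> set (basics p)"

definition operations :: "'a stmt \<Rightarrow> 'a set" where
  "operations p = {u. Op u \<in> set (basics p)}"

fun has_advance :: "'a stmt \<Rightarrow> bool" where
  "has_advance (Basic b) = False"
| "has_advance Advance = True"
| "has_advance (Seq s t) = (has_advance s \<or> has_advance t)"
| "has_advance (Async s) = has_advance s"
| "has_advance (Finish s) = has_advance s"

fun no_clocked_finish :: "'a stmt \<Rightarrow> bool" where
  "no_clocked_finish (Basic b) = True"
| "no_clocked_finish Advance = True"
| "no_clocked_finish (Seq s t) = (no_clocked_finish s \<and> no_clocked_finish t)"
| "no_clocked_finish (Async s) = no_clocked_finish s"
| "no_clocked_finish (Finish s) = (\<not> has_advance s)"

fun asynchronous :: "'a stmt \<Rightarrow> bool" where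
  "asynchronous (Async s) = True"
| "asynchronous (Seq s t) = (asynchronous s \<and> asynchronous t)"
| "asynchronous _ = False"

abbreviation synchronous :: "'a stmt \<Rightarrow> bool" where
  "synchronous s \<equiv> \<not> asynchronous s"

inductive stuck :: "'a stmt \<Rightarrow> bool" where
  stuck_advance: "stuck Advance"
| stuck_async: "stuck s \<Longrightarrow> stuck (Async s)"
| stuck_seq_sync: "synchronous s \<Longrightarrow> stuck s \<Longrightarrow> stuck (Seq s t)"
| stuck_seq_async: "asynchronous s \<Longrightarrow> stuck s \<Longrightarrow> stuck t \<Longrightarrow> stuck (Seq s t)"

inductive clock_step :: "'a stmt \<Rightarrow> 'a stmt \<Rightarrow> bool" where
  clock_advance: "clock_step Advance (Basic Skip)"
| clock_basic: "clock_step (Basic b) (Basic b)"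
| clock_async: "clock_step s t \<Longrightarrow> clock_step (Async s) (Async t)"
| clock_seq_sync: "synchronous s \<Longrightarrow> clock_step s t \<Longrightarrow> clock_step (Seq s u) (Seq t u)"
| clock_seq_async:
    "asynchronous s \<Longrightarrow> clock_step s s' \<Longrightarrow> clock_step t t' \<Longrightarrow> clock_step (Seq s t) (Seq s' t')"

text \<open>
  Every rule of the reduction relation has at most one reduction as premise, so a derivation of a
  reduction ends in exactly one leaf, which either executes a basic statement or applies the clock
  rule. The reduction relation is labelled with that leaf.
\<close>

datatype 'a action = Exec "'a basic" | Tick

inductive step :: "'a stmt \<Rightarrow> 'a action \<Rightarrow> 'a config \<Rightarrow> bool" where
  step_basic: "step (Basic b) (Exec b) Done"
| step_async: "step s a (Cfg s') \<Longrightarrow> step (Async s) a (Cfg (Async s'))"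
| step_finish: "step s a (Cfg s') \<Longrightarrow> step (Finish s) a (Cfg (Finish s'))"
| step_seq_left: "step s a (Cfg s') \<Longrightarrow> step (Seq s t) a (Cfg (Seq s' t))"
| step_seq_right:
    "asynchronous t \<Longrightarrow> step s a (Cfg s') \<Longrightarrow> step (Seq t s) a (Cfg (Seq t s'))"
| step_async_done: "step s a Done \<Longrightarrow> step (Async s) a Done"
| step_finish_done: "step s a Done \<Longrightarrow> step (Finish s) a Done"
| step_seq_left_done: "step s a Done \<Longrightarrow> step (Seq s t) a (Cfg t)"
| step_seq_right_done: "asynchronous t \<Longrightarrow> step s a Done \<Longrightarrow> step (Seq t s) a (Cfg t)"
| step_clock: "stuck s \<Longrightarrow> clock_step s t \<Longrightarrow> step (Finish s) Tick (Cfg (Finish t))"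

inductive steps :: "'a config \<Rightarrow> 'a action list \<Rightarrow> 'a config \<Rightarrow> bool" where
  steps_Nil: "steps c [] c"
| steps_Cons: "step s a c \<Longrightarrow> steps c tr d \<Longrightarrow> steps (Cfg s) (a # tr) d"

text \<open>An interpretation is represented by the actions of a complete reduction sequence.\<close>

definition interpretation_of :: "'a stmt \<Rightarrow> 'a action list \<Rightarrow> bool" where
  "interpretation_of p tr \<longleftrightarrow> steps (Cfg p) tr Done"

definition executed_before :: "'a action list \<Rightarrow> 'a \<Rightarrow> 'a \<Rightarrow> bool" where
  "executed_before tr u v \<longleftrightarrow>
     (\<exists>i j. i < j \<and> j < length tr \<and> tr ! i = Exec (Op u) \<and> tr ! j = Exec (Op v))"

definition happens_before :: "'a stmt \<Rightarrow> 'a \<Rightarrow> 'a \<Rightarrow> bool" where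
  "happens_before p u v \<longleftrightarrow> (\<forall>tr. interpretation_of p tr \<longrightarrow> executed_before tr u v)"

definition phase_in :: "'a action list \<Rightarrow> 'a \<Rightarrow> nat" where
  "phase_in tr u = length (filter (\<lambda>a. a = Tick) (takeWhile (\<lambda>a. a \<noteq> Exec (Op u)) tr))"

text \<open>The phase is the value of \<open>phase_in\<close> common to all interpretations.\<close>

definition phase :: "'a stmt \<Rightarrow> 'a \<Rightarrow> nat" where
  "phase p u = (THE n. \<forall>tr. interpretation_of p tr \<longrightarrow> phase_in tr u = n)"

text \<open>
  Ignoring clocks, every \<open>Advance\<close> becomes an operation. Its name is its position in the syntax
  tree (the sequence of left/right choices at \<open>Seq\<close> nodes, read from the leaf to the root), so the new names are pairwise distinct and
  differ from the names \<open>Inl u\<close> of the original operations.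
\<close>

fun unclock_at :: "bool list \<Rightarrow> 'a stmt \<Rightarrow> ('a + bool list) stmt" where
  "unclock_at \<pi> (Basic b) = Basic (map_basic Inl b)"
| "unclock_at \<pi> Advance = Basic (Op (Inr \<pi>))"
| "unclock_at \<pi> (Seq s t) = Seq (unclock_at (False # \<pi>) s) (unclock_at (True # \<pi>) t)"
| "unclock_at \<pi> (Async s) = Async (unclock_at \<pi> s)"
| "unclock_at \<pi> (Finish s) = Finish (unclock_at \<pi> s)"

definition unclock :: "'a stmt \<Rightarrow> ('a + bool list) stmt" where
  "unclock p = unclock_at [] p"

definition unclocked_happens_before :: "'a stmt \<Rightarrow> 'a \<Rightarrow> 'a \<Rightarrow> bool" where
  "unclocked_happens_before p u v \<longleftrightarrow> happens_before (unclock p) (Inl u) (Inl v)"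

end

(* The happens-before relation has a static description: at a node Seq s t, the operations of s that
   lie outside every async of s (asyncs inside a finish do not count) precede all of t; likewise the phase of an
   operation counts the advances passed on the way to it. Both are invariant under reduction, apart
   from the decrement of all phases at a tick, so the static relations hold in every interpretation.
   Conversely, suppose that u neither precedes v nor has a smaller phase. A scheduler that delays u
   as long as possible executes v first: if u is the only enabled operation, then every other
   operation is preceded by u or lies in a later phase than u. So u happens before v iff u precedes
   v or has a smaller phase. Applying this to the program and to its unclocked version, in which the
   static order is the same and all phases vanish, gives the theorem. *)

theory Submission
  imports Defs
begin

section \<open>Static order and static phases\<close>

lemma operations_simps [simp]:
  "operations (Basic b) = {u. b = Op u}"
  "operations Advance = {}"
  "operations (Seq s t) = operations s \<union> operations t"
  "operations (Async s) = operations s"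
  "operations (Finish s) = operations s"
  by (auto simp: operations_def)

text \<open>Distinctness of \<open>basics\<close> is not invariant, as clock steps may create
  several copies of \<open>Basic Skip\<close>; here only named operations are compared.\<close>

fun disjoint_ops :: "'a stmt \<Rightarrow> bool" where
  "disjoint_ops (Seq s t) \<longleftrightarrow>
     disjoint_ops s \<and> disjoint_ops t \<and> operations s \<inter> operations t = {}"
| "disjoint_ops (Async s) = disjoint_ops s"
| "disjoint_ops (Finish s) = disjoint_ops s"
| "disjoint_ops _ = True"

text \<open>The operations that must all be executed before control passes to a sequel of the
  statement: an \<open>Async\<close> is not waited for, while a \<open>Finish\<close> also waits for
  the asyncs inside it.\<close>

fun sync_ops :: "'a stmt \<Rightarrow> 'a set" where
  "sync_ops (Seq s t) = sync_ops s \<union> sync_ops t"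
| "sync_ops (Async s) = {}"
| "sync_ops s = operations s"

fun precedes :: "'a stmt \<Rightarrow> 'a \<Rightarrow> 'a \<Rightarrow> bool" where
  "precedes (Seq s t) u v \<longleftrightarrow>
     precedes s u v \<or> precedes t u v \<or> u \<in> sync_ops s \<and> v \<in> operations t"
| "precedes (Async s) u v = precedes s u v"
| "precedes (Finish s) u v = precedes s u v"
| "precedes _ u v = False"

text \<open>Advances below a \<open>Finish\<close> are not counted, as they would belong to another clock.\<close>

fun sync_advances :: "'a stmt \<Rightarrow> nat" where
  "sync_advances (Seq s t) = sync_advances s + sync_advances t"
| "sync_advances Advance = 1"
| "sync_advances _ = 0"

fun static_phase :: "'a stmt \<Rightarrow> 'a \<Rightarrow> nat" where
  "static_phase (Seq s t) u =
     (if u \<in> operations s then static_phase s u else sync_advances s + static_phase t u)"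
| "static_phase (Async s) u = static_phase s u"
| "static_phase (Finish s) u = static_phase s u"
| "static_phase _ u = 0"

lemma disjoint_ops_if_distinct: "distinct (basics s) \<Longrightarrow> disjoint_ops s"
  by (induction s) (auto simp: operations_def)

lemma sync_ops_subset: "sync_ops s \<subseteq> operations s"
  by (induction s) auto

lemma precedes_operations: "precedes s u v \<Longrightarrow> u \<in> operations s \<and> v \<in> operations s"
  by (induction s) (auto dest: subsetD[OF sync_ops_subset])

lemma asynchronous_static:
  "asynchronous s \<Longrightarrow> sync_ops s = {} \<and> sync_advances s = 0"
  by (induction s) auto

lemma no_clocked_finish_if_no_advance: "\<not> has_advance s \<Longrightarrow> no_clocked_finish s"
  by (induction s) auto

section \<open>Invariants of reduction\<close>

lemma stuck_has_advance: "stuck s \<Longrightarrow> has_advance s"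
  by (induction rule: stuck.induct) auto

fun executed :: "'a action \<Rightarrow> 'a set" where
  "executed (Exec (Op u)) = {u}"
| "executed _ = {}"

fun config_ops :: "'a config \<Rightarrow> 'a set" where
  "config_ops Done = {}"
| "config_ops (Cfg s) = operations s"

text \<open>A clock rule inside \<open>s\<close> would need an inner \<open>Finish\<close> with a
  stuck body, and a stuck body contains an advance. So only the outermost \<open>Finish\<close> of a
  single-clock program ticks.\<close>

lemma step_not_Tick: "step s a c \<Longrightarrow> no_clocked_finish s \<Longrightarrow> a \<noteq> Tick"
proof (induction rule: step.induct)
qed (auto dest: stuck_has_advance no_clocked_finish_if_no_advance)

lemma clock_step_operations: "clock_step s t \<Longrightarrow> operations t = operations s"
  by (induction rule: clock_step.induct) auto

lemma executed_Exec: "u \<in> executed a \<longleftrightarrow> a = Exec (Op u)"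
  by (cases a rule: executed.cases) auto

lemma executed_operations: "step s a c \<Longrightarrow> executed a \<subseteq> operations s"
  by (induction rule: step.induct) (auto simp: executed_Exec)

lemma step_config_ops:
  "step s a c \<Longrightarrow> disjoint_ops s \<Longrightarrow> config_ops c = operations s - executed a"
proof (induction rule: step.induct)
  case (step_basic b)
  then show ?case by (cases b) auto
qed (auto simp: clock_step_operations dest!: executed_operations)

lemma step_disjoint_ops:
  "step s a (Cfg s') \<Longrightarrow> disjoint_ops s \<Longrightarrow> no_clocked_finish s \<Longrightarrow> disjoint_ops s'"
proof (induction s a "Cfg s'" arbitrary: s' rule: step.induct)
  case (step_clock s t)
  then show ?case using stuck_has_advance by auto
next
  case (step_seq_left s a s' t)
  then show ?case using step_config_ops[OF step_seq_left(1)] by auto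
next
  case (step_seq_right t s a s')
  then show ?case using step_config_ops[OF step_seq_right(2)] by auto
qed (auto intro: no_clocked_finish_if_no_advance)

lemma step_has_advance:
  "step s a (Cfg s') \<Longrightarrow> \<not> has_advance s \<Longrightarrow> \<not> has_advance s'"
proof (induction s a "Cfg s'" arbitrary: s' rule: step.induct)
  case (step_clock s t)
  then show ?case using stuck_has_advance by auto
qed auto

lemma step_no_clocked_finish:
  "step s a (Cfg s') \<Longrightarrow> no_clocked_finish s \<Longrightarrow> no_clocked_finish s'"
proof (induction s a "Cfg s'" arbitrary: s' rule: step.induct)
  case (step_clock s t)
  then show ?case using stuck_has_advance by auto
qed (auto dest: step_has_advance)

lemma step_Done_static:
  "step s a Done \<Longrightarrow> sync_advances s = 0 \<and> sync_ops s \<subseteq> executed a"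
proof (induction s a "Done :: 'a config" rule: step.induct)
  case (step_basic b)
  then show ?case by (cases b) auto
next
  case (step_finish_done s a)
  \<comment> \<open>The induction hypothesis bounds only \<open>sync_ops s\<close>, whereas
    \<open>sync_ops (Finish s)\<close> consists of all operations of \<open>s\<close>; hence a
    separate induction.\<close>
  have "operations s \<subseteq> executed a" using step_finish_done(1)
  proof (induction s a "Done :: 'a config" rule: step.induct)
    case (step_basic b)
    then show ?case by (cases b) auto
  qed auto
  then show ?case by simp
qed auto

text \<open>\<open>Advance\<close> is rewritten only by the clock rule, which acts below a
  \<open>Finish\<close>, where nothing is counted. A left component that disappears has count 0 by
  \<open>step_Done_static\<close>.\<close>

lemma step_sync_advances:
  "step s a (Cfg s') \<Longrightarrow> sync_advances s' = sync_advances s"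
  by (induction s a "Cfg s'" arbitrary: s' rule: step.induct)
    (auto dest: step_Done_static asynchronous_static)

lemma step_sync_ops:
  "step s a (Cfg s') \<Longrightarrow> disjoint_ops s \<Longrightarrow> sync_ops s' = sync_ops s - executed a"
proof (induction s a "Cfg s'" arbitrary: s' rule: step.induct)
  case (step_finish s a s')
  then show ?case using step_config_ops[OF step_finish(1)] by simp
next
  case (step_seq_left s a s' t)
  then show ?case using executed_operations[OF step_seq_left(1)] sync_ops_subset[of t] by auto
next
  case (step_seq_right t s a s')
  then show ?case by (auto dest: asynchronous_static)
next
  case (step_seq_left_done s a t)
  then show ?case
    using executed_operations[OF step_seq_left_done(1)] step_Done_static[OF step_seq_left_done(1)]
      sync_ops_subset[of t] by auto
next
  case (step_seq_right_done t s a)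
  then show ?case
    using step_Done_static[OF step_seq_right_done(2)] by (auto dest: asynchronous_static)
next
  case (step_clock s t)
  then show ?case by (simp add: clock_step_operations)
qed auto

lemma step_static_phase:
  "step s a (Cfg s') \<Longrightarrow> disjoint_ops s \<Longrightarrow> no_clocked_finish s \<Longrightarrow> u \<in> operations s' \<Longrightarrow>
     static_phase s' u = static_phase s u"
proof (induction s a "Cfg s'" arbitrary: s' rule: step.induct)
  case (step_seq_left s a s' t)
  then show ?case
    using step_config_ops[OF step_seq_left(1)] step_sync_advances[OF step_seq_left(1)] by auto
next
  case (step_seq_right t s a s')
  then show ?case using step_config_ops[OF step_seq_right(2)] by auto
next
  case (step_seq_left_done s a t)
  then show ?case using step_Done_static[OF step_seq_left_done(1)] by auto
next
  case (step_clock s t)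
  then show ?case using stuck_has_advance by auto
qed (auto intro: no_clocked_finish_if_no_advance)

lemma clock_step_precedes:
  assumes "clock_step s t"
  shows "sync_ops t = sync_ops s" "precedes t u v = precedes s u v"
    "disjoint_ops t = disjoint_ops s" "no_clocked_finish t = no_clocked_finish s"
  using assms by (induction rule: clock_step.induct) (auto simp: clock_step_operations)

lemma step_precedes:
  "step s a (Cfg s') \<Longrightarrow> disjoint_ops s \<Longrightarrow> u \<in> operations s' \<Longrightarrow> v \<in> operations s' \<Longrightarrow>
     precedes s' u v = precedes s u v"
proof (induction s a "Cfg s'" arbitrary: s' rule: step.induct)
  case (step_seq_left s a s' t)
  have ops: "operations s' = operations s - executed a" "executed a \<subseteq> operations s"
    using step_config_ops[OF step_seq_left(1)] executed_operations[OF step_seq_left(1)]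
      step_seq_left.prems(1) by simp_all
  have "precedes s' u v \<longleftrightarrow> precedes s u v"
  proof (cases "u \<in> operations s' \<and> v \<in> operations s'")
    case True
    then show ?thesis using step_seq_left by simp
  next
    case False
    \<comment> \<open>Whichever of \<open>u\<close> and \<open>v\<close> is missing from
      \<open>s'\<close> lies in \<open>t\<close>, hence by disjointness not in \<open>s\<close>;
      both sides are then false.\<close>
    then have "\<not> (u \<in> operations s \<and> v \<in> operations s)"
      using ops(1) step_seq_left.prems by auto
    then show ?thesis using False precedes_operations by metis
  qed
  moreover have "u \<in> sync_ops s' \<longleftrightarrow> u \<in> sync_ops s"
    using step_sync_ops[OF step_seq_left(1)] ops step_seq_left.prems by auto
  ultimately show ?case by simp
next
  case (step_seq_right t s a s')
  have ops: "operations s' = operations s - executed a"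
    using step_config_ops[OF step_seq_right(2)] step_seq_right.prems(1) by simp
  have "precedes s' u v \<longleftrightarrow> precedes s u v"
  proof (cases "u \<in> operations s' \<and> v \<in> operations s'")
    case True
    then show ?thesis using step_seq_right by simp
  next
    case False
    then have "\<not> (u \<in> operations s \<and> v \<in> operations s)"
      using ops step_seq_right.prems by auto
    then show ?thesis using False precedes_operations by metis
  qed
  then show ?case using asynchronous_static[OF step_seq_right(1)] by simp
next
  case (step_seq_left_done s a t)
  then have "u \<notin> operations s" by auto
  then have "\<not> precedes s u v" "u \<notin> sync_ops s"
    using precedes_operations[of s u v] sync_ops_subset[of s] by auto
  then show ?case by simp
next
  case (step_seq_right_done t s a)
  then have "u \<notin> operations s" by auto
  then have "\<not> precedes s u v" using precedes_operations[of s u v] by auto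
  then show ?case using asynchronous_static[OF step_seq_right_done(1)] by simp
next
  case (step_clock s t)
  then show ?case by (simp add: clock_step_precedes)
qed auto

text \<open>An execution reaches its leaf by going left at \<open>Seq\<close>, or right past an
  asynchronous statement. What is passed on the left thus has no synchronous operation or advance to
  wait for.\<close>

lemma enabled_minimal:
  "step s (Exec (Op v)) c \<Longrightarrow> disjoint_ops s \<Longrightarrow> static_phase s v = 0 \<and> \<not> precedes s u v"
proof (induction s "Exec (Op v)" c rule: step.induct)
  case (step_seq_left s s' t)
  then show ?case
    using executed_operations[OF step_seq_left(1)] precedes_operations[of t u v] by auto
next
  case (step_seq_right t s s')
  then show ?case
    using executed_operations[OF step_seq_right(2)] precedes_operations[of t u v]
    by (auto dest: asynchronous_static)
next
  case (step_seq_left_done s t)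
  then show ?case
    using executed_operations[OF step_seq_left_done(1)] precedes_operations[of t u v] by auto
next
  case (step_seq_right_done t s)
  then show ?case
    using executed_operations[OF step_seq_right_done(2)] precedes_operations[of t u v]
    by (auto dest: asynchronous_static)
qed auto

section \<open>Effect of a clock step on phases\<close>

lemma stuck_simps [simp]:
  "stuck (Seq s t) \<longleftrightarrow> stuck s \<and> (asynchronous s \<longrightarrow> stuck t)"
  "stuck (Async s) \<longleftrightarrow> stuck s"
  "\<not> stuck (Basic b)"
  by (auto elim: stuck.cases intro: stuck.intros)

lemma stuck_clock_step: "stuck s \<Longrightarrow> \<exists>t. clock_step s t"
  by (induction rule: stuck.induct) (blast intro: clock_step.intros)+

lemma clock_step_asynchronous: "clock_step s t \<Longrightarrow> asynchronous t = asynchronous s"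
  by (induction rule: clock_step.induct) auto

text \<open>The step descends to the leading synchronous component and there replaces exactly one
  synchronous advance; asynchronous components count 0. Stuckness excludes
  \<open>clock_basic\<close>, which changes nothing.\<close>

lemma clock_step_sync_advances:
  "clock_step s t \<Longrightarrow> stuck s \<Longrightarrow> synchronous s \<Longrightarrow> sync_advances s = Suc (sync_advances t)"
  by (induction rule: clock_step.induct)
    (auto simp: clock_step_asynchronous asynchronous_static)

text \<open>Every operation of a stuck statement waits behind an advance that this step removes:
  within a stepping component by induction, to the right of a synchronous one because its
  \<open>sync_advances\<close> drops by one.\<close>

lemma clock_step_static_phase:
  "clock_step s t \<Longrightarrow> stuck s \<Longrightarrow> u \<in> operations s \<Longrightarrow>
     static_phase s u = Suc (static_phase t u)"
proof (induction rule: clock_step.induct)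
  case (clock_seq_sync s t u)
  then show ?case
    by (simp add: clock_step_operations clock_step_sync_advances)
next
  case (clock_seq_async s s' t t')
  then show ?case
    by (auto simp: clock_step_operations asynchronous_static clock_step_asynchronous)
qed auto

section \<open>Progress and termination\<close>

lemma progress: "no_clocked_finish s \<Longrightarrow> stuck s \<or> (\<exists>a c. step s a c)"
proof (induction s)
  case (Seq s t)
  then consider "stuck s" | a c where "step s a c" by auto
  then show ?case
  proof cases
    case 1
    show ?thesis
    proof (cases "asynchronous s")
      case True
      from Seq consider "stuck t" | a c where "step t a c" by auto
      then show ?thesis
      proof cases
        case (2 a c)
        with True show ?thesis by (cases c) (auto intro: step.intros)
      qed (use True \<open>stuck s\<close> in \<open>auto intro: stuck.intros\<close>)
    qed (use 1 in \<open>auto intro: stuck.intros\<close>)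
  next
    case (2 a c)
    then show ?thesis by (cases c) (auto intro: step.intros)
  qed
next
  case (Async s)
  then consider "stuck s" | a c where "step s a c" by auto
  then show ?case
  proof cases
    case (2 a c)
    then show ?thesis by (cases c) (auto intro: step.intros)
  qed (auto intro: stuck.intros)
next
  case (Finish s)
  \<comment> \<open>The body of an inner \<open>Finish\<close> contains no advance, so it is not
    stuck.\<close>
  then obtain a c where "step s a c"
    using stuck_has_advance no_clocked_finish_if_no_advance by auto
  then show ?case by (cases c) (auto intro: step.intros)
qed (auto intro: step.intros stuck.intros)

text \<open>Holds vacuously for statements without any step. This is intended: a stuck component
  delays its sequel by an advance rather than by \<open>u\<close>.\<close>

definition forces :: "'a stmt \<Rightarrow> 'a \<Rightarrow> bool" where
  "forces s u \<longleftrightarrow> (\<forall>a c. step s a c \<longrightarrow> a = Exec (Op u))"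

lemma forces_simps:
  "forces (Basic b) u \<longleftrightarrow> b = Op u"
  "forces (Async s) u \<Longrightarrow> forces s u"
  "forces (Finish s) u \<Longrightarrow> forces s u"
  "forces (Seq s t) u \<Longrightarrow> forces s u"
  "forces (Seq s t) u \<Longrightarrow> asynchronous s \<Longrightarrow> forces t u"
proof -
  show "forces (Basic b) u \<longleftrightarrow> b = Op u"
    by (auto simp: forces_def elim: step.cases intro: step_basic)
  show "forces s u" if "forces (Async s) u"
    using that unfolding forces_def by (metis config.exhaust step_async step_async_done)
  show "forces s u" if "forces (Finish s) u"
    using that unfolding forces_def by (metis config.exhaust step_finish step_finish_done)
  show "forces s u" if "forces (Seq s t) u"
    using that unfolding forces_def by (metis config.exhaust step_seq_left step_seq_left_done)
  show "forces t u" if "forces (Seq s t) u" "asynchronous s"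
    using that unfolding forces_def by (metis config.exhaust step_seq_right step_seq_right_done)
qed

text \<open>Descend to the component that blocks the sequel: it is \<open>u\<close> itself, an
  \<open>Advance\<close>, or a \<open>Finish\<close>. The last contains no advance, so it does have
  a step, which must execute \<open>u\<close>.\<close>

lemma forces_sync:
  "forces s u \<Longrightarrow> no_clocked_finish s \<Longrightarrow> synchronous s \<Longrightarrow>
     u \<in> sync_ops s \<or> 0 < sync_advances s"
proof (induction s)
  case (Finish s)
  then obtain a c where st: "step s a c"
    using progress[of s] stuck_has_advance[of s] no_clocked_finish_if_no_advance[of s] by auto
  then have "a = Exec (Op u)"
    using forces_simps(3)[OF Finish.prems(1)] by (auto simp: forces_def)
  then show ?case using executed_operations[OF st] by simp
next
  case (Seq s t)
  then show ?case using forces_simps(4,5)[OF Seq.prems(1)] by (cases "asynchronous s") auto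
qed (auto simp: forces_simps(1))

text \<open>At \<open>Seq s t\<close> with \<open>s\<close> synchronous, \<open>forces_sync\<close>
  places all of \<open>t\<close> behind \<open>u\<close> or behind an advance; with \<open>s\<close>
  asynchronous, both components are forced.\<close>

lemma forces_precedes:
  "forces s u \<Longrightarrow> no_clocked_finish s \<Longrightarrow> disjoint_ops s \<Longrightarrow> v \<in> operations s \<Longrightarrow> v \<noteq> u \<Longrightarrow>
     precedes s u v \<or> 0 < static_phase s v"
proof (induction s)
  case (Seq s t)
  then show ?case
    using forces_simps(4,5)[OF Seq.prems(1)] forces_sync[of s u]
    by (cases "asynchronous s") auto
next
  case (Finish s)
  then show ?case
    using forces_simps(3)[OF Finish.prems(1)] no_clocked_finish_if_no_advance[of s] by simp
qed (auto simp: forces_simps(1) dest: forces_simps(2))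

text \<open>A termination measure. \<open>Advance\<close> weighs 2 because a clock step turns it
  into \<open>Basic Skip\<close> of weight 1, so that ticks decrease the measure too.\<close>

fun weight :: "'a stmt \<Rightarrow> nat" where
  "weight (Basic b) = 1"
| "weight Advance = 2"
| "weight (Seq s t) = weight s + weight t"
| "weight (Async s) = weight s"
| "weight (Finish s) = weight s"

lemma weight_pos [simp]: "0 < weight s"
  by (induction s) auto

lemma clock_step_weight: "clock_step s t \<Longrightarrow> stuck s \<Longrightarrow> weight t < weight s"
  by (induction rule: clock_step.induct) (auto intro: add_strict_mono)

lemma step_weight: "step s a (Cfg s') \<Longrightarrow> weight s' < weight s"
  by (induction s a "Cfg s'" arbitrary: s' rule: step.induct) (auto simp: clock_step_weight)

section \<open>Interpretations of single-clock programs\<close>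

definition single_clock :: "'a stmt \<Rightarrow> bool" where
  "single_clock r \<longleftrightarrow> no_clocked_finish r \<and> disjoint_ops r"

lemma interpretation_of_Nil: "\<not> interpretation_of s []"
  by (auto simp: interpretation_of_def elim: steps.cases)

lemma steps_Done: "steps Done tr c \<longleftrightarrow> tr = [] \<and> c = Done"
  by (auto elim: steps.cases intro: steps.intros)

lemma interpretation_of_Cons:
  "interpretation_of s (a # tr) \<longleftrightarrow>
     (step s a Done \<and> tr = []) \<or> (\<exists>s'. step s a (Cfg s') \<and> interpretation_of s' tr)"
proof
  assume "interpretation_of s (a # tr)"
  then obtain c where "step s a c" "steps c tr Done"
    unfolding interpretation_of_def by (auto elim: steps.cases)
  then show "(step s a Done \<and> tr = []) \<or> (\<exists>s'. step s a (Cfg s') \<and> interpretation_of s' tr)"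
    by (cases c) (auto simp: steps_Done interpretation_of_def)
qed (auto simp: interpretation_of_def intro: steps.intros)

lemma step_Finish_cases:
  assumes "step (Finish r) a c" "single_clock r"
  obtains (final) "c = Done" "operations r \<subseteq> executed a" "a \<noteq> Tick"
  | (cfg) r' where "c = Cfg (Finish r')" "single_clock r'" "weight r' < weight r"
      "operations r' = operations r - executed a"
      "\<And>u. u \<in> operations r' \<Longrightarrow> static_phase r u = of_bool (a = Tick) + static_phase r' u"
      "\<And>u v. u \<in> operations r' \<Longrightarrow> v \<in> operations r' \<Longrightarrow> precedes r' u v = precedes r u v"
  using assms(1)
proof cases
  case (step_finish r')
  have inv: "no_clocked_finish r" "disjoint_ops r" using assms(2) by (auto simp: single_clock_def)
  show ?thesis
  proof (rule cfg)
    show "c = Cfg (Finish r')" by fact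
    show "single_clock r'"
      using inv step_finish step_no_clocked_finish step_disjoint_ops
      by (auto simp: single_clock_def)
    show "weight r' < weight r" using step_weight step_finish by blast
    show "operations r' = operations r - executed a"
      using step_config_ops[OF step_finish(2)] inv by simp
    \<comment> \<open>A step of \<open>r\<close> itself is never a tick, so the summand is 0 and
      phases are unchanged; it is 1 only for the clock rule of the outer
      \<open>Finish\<close>.\<close>
    show "static_phase r u = of_bool (a = Tick) + static_phase r' u" if "u \<in> operations r'" for u
      using that step_static_phase[OF step_finish(2)] step_not_Tick[OF step_finish(2)] inv by simp
    show "precedes r' u v = precedes r u v" if "u \<in> operations r'" "v \<in> operations r'" for u v
      using that step_precedes[OF step_finish(2)] inv by simp
  qed
next
  case step_finish_done
  then show ?thesis
    using assms(2) final step_config_ops[of r a Done] step_not_Tick[of r a Done]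
    by (auto simp: single_clock_def)
next
  case (step_clock t)
  show ?thesis
  proof (rule cfg)
    show "c = Cfg (Finish t)" by fact
    show "single_clock t"
      using assms(2) clock_step_precedes[OF step_clock(4)] by (simp add: single_clock_def)
    show "weight t < weight r" using clock_step_weight step_clock by blast
    show "operations t = operations r - executed a"
      using step_clock by (simp add: clock_step_operations)
    show "static_phase r u = of_bool (a = Tick) + static_phase t u" if "u \<in> operations t" for u
      using that step_clock clock_step_static_phase by (simp add: clock_step_operations)
    show "precedes t u v = precedes r u v" for u v
      using clock_step_precedes[OF step_clock(4)] by simp
  qed
qed

text \<open>A stuck body ticks, any other body steps by \<open>progress\<close>, and
  \<open>weight\<close> decreases. Existence keeps \<open>happens_before\<close> from holding
  vacuously.\<close>

lemma interpretation_exists: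
  "single_clock r \<Longrightarrow> \<exists>tr. interpretation_of (Finish r) tr"
proof (induction "weight r" arbitrary: r rule: less_induct)
  case less
  have "\<exists>a c. step (Finish r) a c"
  proof (cases "stuck r")
    case True
    then show ?thesis using stuck_clock_step step_clock by blast
  next
    case False
    then obtain a c where "step r a c" using progress[of r] less.prems by (auto simp: single_clock_def)
    then show ?thesis by (cases c) (auto intro: step.intros)
  qed
  then obtain a c where st: "step (Finish r) a c" by blast
  then show ?case using less.prems
  proof (cases rule: step_Finish_cases)
    case final
    then have "interpretation_of (Finish r) [a]" using st by (simp add: interpretation_of_Cons)
    then show ?thesis ..
  next
    case (cfg r')
    then obtain tr where "interpretation_of (Finish r') tr" using less.hyps by blast
    then have "interpretation_of (Finish r) (a # tr)"
      using st cfg by (auto simp: interpretation_of_Cons)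
    then show ?thesis ..
  qed
qed

lemma interpretation_induct [consumes 2, case_names final cfg]:
  assumes "interpretation_of (Finish r) tr" "single_clock r"
    and "\<And>r a. single_clock r \<Longrightarrow> step (Finish r) a Done \<Longrightarrow> operations r \<subseteq> executed a \<Longrightarrow>
      a \<noteq> Tick \<Longrightarrow> P r [a]"
    and "\<And>r a r' tr. single_clock r \<Longrightarrow> step (Finish r) a (Cfg (Finish r')) \<Longrightarrow>
      interpretation_of (Finish r') tr \<Longrightarrow> single_clock r' \<Longrightarrow>
      operations r' = operations r - executed a \<Longrightarrow>
      (\<And>u. u \<in> operations r' \<Longrightarrow> static_phase r u = of_bool (a = Tick) + static_phase r' u) \<Longrightarrow>
      (\<And>u v. u \<in> operations r' \<Longrightarrow> v \<in> operations r' \<Longrightarrow> precedes r' u v = precedes r u v) \<Longrightarrow>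
      P r' tr \<Longrightarrow> P r (a # tr)"
  shows "P r tr"
  using assms(1,2)
proof (induction tr arbitrary: r)
  case (Cons a tr)
  from Cons.prems(1) consider "step (Finish r) a Done" "tr = []"
    | s' where "step (Finish r) a (Cfg s')" "interpretation_of s' tr"
    by (auto simp: interpretation_of_Cons)
  then show ?case
  proof cases
    case 1
    from 1(1) Cons.prems(2) show ?thesis
      by (cases rule: step_Finish_cases) (use 1 Cons.prems(2) assms(3) in auto)
  next
    case (2 s')
    from 2(1) Cons.prems(2) show ?thesis
    proof (cases rule: step_Finish_cases)
      case (cfg r')
      have st: "step (Finish r) a (Cfg (Finish r'))" and int: "interpretation_of (Finish r') tr"
        using 2 cfg(1) by simp_all
      show ?thesis
        by (rule assms(4)[OF Cons.prems(2) st int cfg(2,4-6) Cons.IH[OF int cfg(2)]])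
    qed simp
  qed
qed (auto simp: interpretation_of_Nil)

lemma set_interpretation:
  "interpretation_of (Finish r) tr \<Longrightarrow> single_clock r \<Longrightarrow>
     Exec (Op u) \<in> set tr \<longleftrightarrow> u \<in> operations r"
proof (induction rule: interpretation_induct)
  case (final r a)
  then have "operations r = executed a" using executed_operations[OF final(2)] by simp
  then show ?case by (auto simp: executed_Exec)
next
  case (cfg r a r' tr)
  then have "operations r = executed a \<union> operations r'"
    using executed_operations[OF cfg(2)] by auto
  then show ?case using cfg.IH by (auto simp: executed_Exec)
qed

section \<open>Execution order and phases along an interpretation\<close>

lemma executed_before_Cons:
  "executed_before (a # tr) u v \<longleftrightarrow>
     a = Exec (Op u) \<and> Exec (Op v) \<in> set tr \<or> executed_before tr u v"
proof
  assume "executed_before (a # tr) u v"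
  then obtain i j where ij: "i < j" "j < Suc (length tr)" "(a # tr) ! i = Exec (Op u)"
    "(a # tr) ! j = Exec (Op v)"
    by (auto simp: executed_before_def)
  then obtain j' where "j = Suc j'" by (cases j) auto
  then show "a = Exec (Op u) \<and> Exec (Op v) \<in> set tr \<or> executed_before tr u v"
    using ij by (cases i) (auto simp: executed_before_def in_set_conv_nth)
next
  assume "a = Exec (Op u) \<and> Exec (Op v) \<in> set tr \<or> executed_before tr u v"
  then show "executed_before (a # tr) u v"
  proof (elim disjE conjE)
    assume "a = Exec (Op u)" "Exec (Op v) \<in> set tr"
    then obtain j where "j < length tr" "tr ! j = Exec (Op v)" by (auto simp: in_set_conv_nth)
    then show ?thesis
      using \<open>a = _\<close> unfolding executed_before_def
      by (intro exI[of _ 0] exI[of _ "Suc j"]) auto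
  next
    assume "executed_before tr u v"
    then obtain i j where "i < j" "j < length tr" "tr ! i = Exec (Op u)" "tr ! j = Exec (Op v)"
      by (auto simp: executed_before_def)
    then show ?thesis
      unfolding executed_before_def by (intro exI[of _ "Suc i"] exI[of _ "Suc j"]) auto
  qed
qed

lemma executed_before_set:
  "executed_before tr u v \<Longrightarrow> Exec (Op u) \<in> set tr \<and> Exec (Op v) \<in> set tr"
  by (auto simp: executed_before_def in_set_conv_nth dest: less_trans)

lemma executed_before_irrefl:
  "interpretation_of (Finish r) tr \<Longrightarrow> single_clock r \<Longrightarrow> \<not> executed_before tr u u"
proof (induction rule: interpretation_induct)
  case (final r a)
  then show ?case by (auto simp: executed_before_def)
next
  case (cfg r a r' tr)
  then show ?case using set_interpretation[OF cfg(3,4)] by (auto simp: executed_before_Cons)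
qed

text \<open>Each tick lowers the static phase of a pending operation by one, and when the operation
  is executed its phase is 0 by \<open>enabled_minimal\<close>.\<close>

lemma phase_in_interpretation:
  "interpretation_of (Finish r) tr \<Longrightarrow> single_clock r \<Longrightarrow> u \<in> operations r \<Longrightarrow>
     phase_in tr u = static_phase r u"
proof (induction rule: interpretation_induct)
  case (final r a)
  then have "a = Exec (Op u)" using executed_Exec by fast
  then show ?case
    using enabled_minimal[of "Finish r" u Done] final by (auto simp: phase_in_def single_clock_def)
next
  case (cfg r a r' tr)
  show ?case
  proof (cases "a = Exec (Op u)")
    case True
    then show ?thesis
      using enabled_minimal[of "Finish r" u] cfg(1,2) by (auto simp: phase_in_def single_clock_def)
  next
    case False
    then have "u \<in> operations r'" using cfg executed_Exec by fast
    then show ?thesis using False cfg by (simp add: phase_in_def)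
  qed
qed

lemma phase_eq_static_phase:
  assumes "single_clock r" "u \<in> operations r"
  shows "phase (Finish r) u = static_phase r u"
  unfolding phase_def
  \<comment> \<open>Without an interpretation every number would satisfy the description; existence
    makes the value unique.\<close>
  using interpretation_exists[OF assms(1)] phase_in_interpretation[OF _ assms]
  by (intro the_equality) auto

text \<open>By \<open>enabled_minimal\<close>, \<open>v\<close> cannot be executed while
  \<open>u\<close> is pending. A step that executes neither preserves the assumption, since a tick
  lowers both phases by one.\<close>

lemma executed_before_if_static:
  "interpretation_of (Finish r) tr \<Longrightarrow> single_clock r \<Longrightarrow> u \<in> operations r \<Longrightarrow> v \<in> operations r \<Longrightarrow>
     precedes r u v \<or> static_phase r u < static_phase r v \<Longrightarrow> executed_before tr u v"
proof (induction rule: interpretation_induct)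
  case (final r a)
  then have "a = Exec (Op v)" using executed_Exec by fast
  then show ?case using enabled_minimal[of "Finish r" v Done u] final by (auto simp: single_clock_def)
next
  case (cfg r a r' tr)
  have av: "a \<noteq> Exec (Op v)"
    using enabled_minimal[of "Finish r" v _ u] cfg by (auto simp: single_clock_def)
  then have v: "v \<in> operations r'" using cfg executed_Exec by fast
  show ?case
  proof (cases "a = Exec (Op u)")
    case True
    then show ?thesis using v set_interpretation[OF cfg(3,4)] by (simp add: executed_before_Cons)
  next
    case False
    then have u: "u \<in> operations r'" using cfg executed_Exec by fast
    then have "precedes r' u v \<or> static_phase r' u < static_phase r' v"
      using v cfg.hyps(6)[OF u] cfg.hyps(6)[OF v] cfg.hyps(7)[OF u v] cfg.prems by auto
    then show ?thesis using cfg u v by (simp add: executed_before_Cons)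
  qed
qed

text \<open>If \<open>v\<close> has phase 0, then \<open>forces_precedes\<close> shows that
  \<open>u\<close> is not the only possible step. If the phase of \<open>v\<close> is positive, so
  is that of \<open>u\<close>, and \<open>u\<close> is not enabled at all.\<close>

lemma delaying_step:
  assumes "single_clock r" "u \<in> operations r" "v \<in> operations r" "u \<noteq> v"
    and "\<not> precedes r u v" "static_phase r v \<le> static_phase r u"
  obtains a c where "step (Finish r) a c" "a \<noteq> Exec (Op u)"
proof (cases "static_phase r v")
  case 0
  then have "\<not> forces r u"
    using assms forces_precedes[of r u v] by (auto simp: single_clock_def)
  then obtain a c where "step r a c" "a \<noteq> Exec (Op u)" by (auto simp: forces_def)
  then show ?thesis by (cases c) (auto intro: step.intros that)
next
  case (Suc n)
  obtain tr where tr: "interpretation_of (Finish r) tr"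
    using interpretation_exists[OF assms(1)] ..
  then obtain a tr' where "tr = a # tr'"
    using interpretation_of_Nil by (cases tr) auto
  with tr obtain c where st: "step (Finish r) a c" by (auto simp: interpretation_of_Cons)
  moreover have "a \<noteq> Exec (Op u)"
    using enabled_minimal[of "Finish r" u c] st assms Suc by (auto simp: single_clock_def)
  ultimately show ?thesis by (rule that)
qed

text \<open>The steps of \<open>delaying_step\<close> are iterated; the assumptions persist while
  both operations are pending, because a tick lowers both phases equally.\<close>

lemma delaying_interpretation:
  assumes "single_clock r" "u \<in> operations r" "v \<in> operations r" "u \<noteq> v"
    and "\<not> precedes r u v" "static_phase r v \<le> static_phase r u"
  shows "\<exists>tr. interpretation_of (Finish r) tr \<and> \<not> executed_before tr u v"
  using assms
proof (induction "weight r" arbitrary: r rule: less_induct)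
  case less
  obtain a c where st: "step (Finish r) a c" and a: "a \<noteq> Exec (Op u)"
    using delaying_step[OF less.prems] .
  from st less.prems(1) show ?case
  proof (cases rule: step_Finish_cases)
    case final
    then show ?thesis using a less.prems(2) executed_Exec by fast
  next
    case (cfg r')
    have u: "u \<in> operations r'" using a less.prems(2) cfg executed_Exec by fast
    have "\<exists>tr. interpretation_of (Finish r') tr \<and> \<not> executed_before tr u v"
    proof (cases "a = Exec (Op v)")
      case True
      \<comment> \<open>Now \<open>v\<close> is gone and cannot be executed after \<open>u\<close>,
        so any completion serves.\<close>
      obtain tr where tr: "interpretation_of (Finish r') tr"
        using interpretation_exists[OF cfg(2)] ..
      moreover have "v \<notin> operations r'" using cfg True by simp
      ultimately show ?thesis
        using set_interpretation[OF tr cfg(2), of v] executed_before_set[of tr u v] by auto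
    next
      case False
      then have v: "v \<in> operations r'" using less.prems(3) cfg executed_Exec by fast
      show ?thesis
        using less.hyps[OF cfg(3,2) u v] less.prems cfg(5)[OF u] cfg(5)[OF v] cfg(6)[OF u v]
        by simp
    qed
    then obtain tr where "interpretation_of (Finish r') tr" "\<not> executed_before tr u v" by blast
    then have "interpretation_of (Finish r) (a # tr)" "\<not> executed_before (a # tr) u v"
      using st a cfg(1) by (auto simp: interpretation_of_Cons executed_before_Cons)
    then show ?thesis by blast
  qed
qed

theorem happens_before_iff_static:
  assumes "single_clock r" "u \<in> operations r" "v \<in> operations r"
  shows "happens_before (Finish r) u v \<longleftrightarrow>
    static_phase r u < static_phase r v \<or> precedes r u v"
proof
  assume hb: "happens_before (Finish r) u v"
  \<comment> \<open>The delaying scheduler needs distinct operations; \<open>u = v\<close> is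
    excluded because an interpretation exists and executes \<open>u\<close> only once.\<close>
  then have "u \<noteq> v"
    using interpretation_exists[OF assms(1)] executed_before_irrefl[OF _ assms(1)]
    by (auto simp: happens_before_def)
  then show "static_phase r u < static_phase r v \<or> precedes r u v"
    using delaying_interpretation[OF assms] hb by (fastforce simp: happens_before_def)
next
  assume "static_phase r u < static_phase r v \<or> precedes r u v"
  then show "happens_before (Finish r) u v"
    using executed_before_if_static[OF _ assms] by (auto simp: happens_before_def)
qed

section \<open>Ignoring clocks\<close>

lemma Inl_operations_unclock_at [simp]:
  "Inl u \<in> operations (unclock_at \<pi> s) \<longleftrightarrow> u \<in> operations s"
proof (induction s arbitrary: \<pi>)
  case (Basic b)
  then show ?case by (cases b) auto
qed auto

text \<open>Positions are read from leaf to root, so the names of all advances below a node have the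
  position of that node as a suffix.\<close>

lemma Inr_operations_unclock_at:
  "Inr \<rho> \<in> operations (unclock_at \<pi> s) \<Longrightarrow> \<exists>\<sigma>. \<rho> = \<sigma> @ \<pi>"
proof (induction s arbitrary: \<pi>)
  case (Basic b)
  then show ?case by (cases b) auto
next
  case (Seq s t)
  then show ?case by fastforce
qed auto

lemma disjoint_ops_unclock_at: "disjoint_ops s \<Longrightarrow> disjoint_ops (unclock_at \<pi> s)"
proof (induction s arbitrary: \<pi>)
  case (Seq s t)
  have "w \<notin> operations (unclock_at (True # \<pi>) t)"
    if w: "w \<in> operations (unclock_at (False # \<pi>) s)" for w
  proof (cases w)
    case (Inl u)
    then show ?thesis using w Seq.prems by auto
  next
    case (Inr \<rho>)
    \<comment> \<open>A common name would end both in \<open>False # \<pi>\<close> and in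
      \<open>True # \<pi>\<close>, two different suffixes of the same length.\<close>
    then show ?thesis
      using w Inr_operations_unclock_at[of \<rho> "False # \<pi>" s]
        Inr_operations_unclock_at[of \<rho> "True # \<pi>" t] by auto
  qed
  then show ?case using Seq by auto
qed auto

lemma has_advance_unclock_at: "\<not> has_advance (unclock_at \<pi> s)"
  by (induction s arbitrary: \<pi>) auto

lemma static_phase_no_advance:
  "\<not> has_advance s \<Longrightarrow> sync_advances s = 0 \<and> static_phase s u = 0"
  by (induction s) auto

lemma sync_ops_unclock_at [simp]: "Inl u \<in> sync_ops (unclock_at \<pi> s) \<longleftrightarrow> u \<in> sync_ops s"
proof (induction s arbitrary: \<pi>)
  case (Basic b)
  then show ?case by (cases b) auto
qed auto

lemma precedes_unclock_at [simp]:
  "precedes (unclock_at \<pi> s) (Inl u) (Inl v) \<longleftrightarrow> precedes s u v"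
  by (induction s arbitrary: \<pi>) auto

lemma unclocked_happens_before_iff_precedes:
  assumes "disjoint_ops r" "u \<in> operations r" "v \<in> operations r"
  shows "unclocked_happens_before (Finish r) u v \<longleftrightarrow> precedes r u v"
proof -
  \<comment> \<open>The static characterisation applies to the unclocked body as well: having no
    advances, it has no clocked finish, and all its phases are 0.\<close>
  have "single_clock (unclock_at [] r)"
    using assms(1) disjoint_ops_unclock_at has_advance_unclock_at no_clocked_finish_if_no_advance
    unfolding single_clock_def by blast
  then show ?thesis
    using happens_before_iff_static[of "unclock_at [] r" "Inl u" "Inl v"] assms(2,3)
      static_phase_no_advance[OF has_advance_unclock_at[of "[]" r]]
    by (simp add: unclocked_happens_before_def unclock_def)
qed

theorem mainTheorem2:
  fixes r :: "'a stmt" and u v :: 'a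
  assumes "program (Finish r)"
    and "no_clocked_finish r"
    and "u \<in> operations (Finish r)"
    and "v \<in> operations (Finish r)"
  shows "happens_before (Finish r) u v \<longleftrightarrow>
    phase (Finish r) u < phase (Finish r) v \<or> unclocked_happens_before (Finish r) u v"
proof -
  have "disjoint_ops r"
    using assms(1) disjoint_ops_if_distinct by (auto simp: program_def)
  moreover from this have "single_clock r" using assms(2) by (simp add: single_clock_def)
  ultimately show ?thesis
    using assms(3,4)
    by (simp add: happens_before_iff_static phase_eq_static_phase
        unclocked_happens_before_iff_precedes)
qed

end
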